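(* Let $A_3=\frac1z\frac{d}{dz}$. For $k=1,2,3,\dots$ the following representation is valid: $$A_3^{k}=\sum_{s=0}^{k}(-1)^{k-s}(2k-2s-1)!!\binom{2k-s-1}{s-1}\frac{1}{z^{2k-s}}\Big(\frac{d}{dz}\Big)^{s}.$$
   Context: Conventions: $(-1)!!=1$, and $\binom{p}{-1}=0$ (so that the term $s=0$ vanishes). $A_3^{k}$ is the $k$-fold composition; operators act on entire and meromorphic functions on $\mathbb{C}$. *)

theory Defs
  imports "HOL-Complex_Analysis.Complex_Analysis"
begin

text \<open>
  Double factorial of an integer, with the convention \<open>(-1)!! = 1\<close>
  (arguments below \<open>-1\<close> are also sent to 1, as a junk value).
\<close>

function dfact :: "int \<Rightarrow> int" where
  "dfact n = (if n \<le> 0 then 1 else n * dfact (n - 2))"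
  by auto
termination by (relation "Wellfounded.measure nat") auto

declare dfact.simps [simp del]

text \<open>
  Binomial coefficient with an integer lower entry, zero if that entry is negative.
\<close>

definition binom :: "nat \<Rightarrow> int \<Rightarrow> nat" where
  "binom p q = (if q < 0 then 0 else p choose nat q)"

text \<open>
  The operator \<open>(1/z) d/dz\<close> on meromorphic functions. A meromorphic function is
  represented by a total function; \<^const>\<open>remove_sings\<close> picks the canonical
  representative (removable singularities filled in, value 0 at poles), so that
  equality of canonical representatives is equality of meromorphic functions. In
  particular the value at the origin is the limit there whenever it exists, as for even
  entire functions.
\<close>

definition A3 :: "(complex \<Rightarrow> complex) \<Rightarrow> complex \<Rightarrow> complex" where
  "A3 f = remove_sings (\<lambda>z. 1 / z * deriv f z)"

end

theory Submission
  imports Defs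
begin

text \<open>
  Applying \<open>(1/z) d/dz\<close> to \<open>(deriv ^^ s) f z / z ^ (2k - s)\<close> feeds the terms with
  indices \<open>s + 1\<close> and \<open>s\<close> of the next sum, so the coefficients have to satisfy
  \<open>c (k + 1) (s + 1) = c k s - (2k - s - 1) c k (s + 1)\<close>. This is Pascal's rule together with the
  absorption identity for binomial coefficients. The computation is valid at every nonzero point
  where \<open>f\<close> is analytic; such points fill a punctured neighbourhood of every point, which is all
  that \<^const>\<open>remove_sings\<close> depends on.
\<close>

definition A3_coeff :: "nat \<Rightarrow> nat \<Rightarrow> complex" where
  "A3_coeff k s = (-1) ^ (k - s)
      * of_int (dfact (2 * int k - 2 * int s - 1))
      * of_nat (binom (2 * k - s - 1) (int s - 1))"

lemma A3_coeff_0 [simp]: "A3_coeff k 0 = 0"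
  by (simp add: A3_coeff_def binom_def)

lemma A3_coeff_diag: "A3_coeff (Suc k) (Suc k) = 1"
  by (simp add: A3_coeff_def binom_def dfact.simps)

text \<open>The upper entry of the binomial coefficient is \<open>k - 2\<close>, truncated at 0,
  hence below the lower entry \<open>k\<close>. At \<open>k = 0\<close> the value would be
  \<open>0 choose 0 = 1\<close>.\<close>

lemma A3_coeff_above_diag: "k \<ge> 1 \<Longrightarrow> A3_coeff k (Suc k) = 0"
  by (simp add: A3_coeff_def binom_def)

text \<open>This is the recurrence for the coefficients at \<open>k = m + s + 1\<close>, with the
  sign and \<open>dfact (2m - 1)\<close> cancelled; \<open>2m + 1\<close> is the ratio of
  consecutive double factorials.\<close>

lemma binom_rec:
  "(2 * m + 1) * binom (2 * m + s + 2) (int s) =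
     (2 * m + 1) * binom (2 * m + s + 1) (int s - 1) + (2 * m + s + 1) * binom (2 * m + s) (int s)"
proof -
  have pascal: "binom (2 * m + s + 2) (int s) =
      binom (2 * m + s + 1) (int s - 1) + ((2 * m + s + 1) choose s)"
    \<comment> \<open>For \<open>s = 0\<close> the convention that \<open>binom p (-1)\<close> is 0
      supplies the boundary case of Pascal's rule.\<close>
    by (cases s) (simp_all add: binom_def nat_add_distrib)
  have absorb: "(2 * m + 1) * ((2 * m + s + 1) choose s) = (2 * m + s + 1) * ((2 * m + s) choose s)"
    using binomial_absorb_comp[of "2 * m + s + 1" s] by simp
  have "(2 * m + 1) * binom (2 * m + s + 2) (int s) =
      (2 * m + 1) * binom (2 * m + s + 1) (int s - 1) + (2 * m + 1) * ((2 * m + s + 1) choose s)"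
    unfolding pascal by (rule distrib_left)
  then show ?thesis
    unfolding absorb by (simp add: binom_def)
qed

lemma A3_coeff_Suc:
  assumes "k \<ge> 1" "s \<le> k"
  shows "A3_coeff (Suc k) (Suc s) = A3_coeff k s - of_nat (2 * k - Suc s) * A3_coeff k (Suc s)"
proof (cases "s = k")
  case True
  \<comment> \<open>On the diagonal, where \<open>m\<close> below would be -1, the recurrence reads
    \<open>1 = 1 - 0\<close>.\<close>
  then show ?thesis
    using assms A3_coeff_diag[of k] A3_coeff_diag[of "k - 1"] A3_coeff_above_diag[of k] by simp
next
  case False
  define m where "m = k - Suc s"
  have k: "k = m + Suc s" using False assms by (simp add: m_def)
  define d where "d = dfact (2 * int m - 1)"
  have d: "dfact (2 * int m + 1) = (2 * int m + 1) * d"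
    by (subst dfact.simps) (simp add: d_def)
  have 1: "A3_coeff (Suc k) (Suc s) =
      (-1) ^ (m + 1) * of_int d * of_nat ((2 * m + 1) * binom (2 * m + s + 2) (int s))"
    by (simp add: A3_coeff_def k algebra_simps d[simplified algebra_simps])
  have 2: "A3_coeff k s =
      (-1) ^ (m + 1) * of_int d * of_nat ((2 * m + 1) * binom (2 * m + s + 1) (int s - 1))"
    by (simp add: A3_coeff_def k algebra_simps d[simplified algebra_simps])
  have 3: "A3_coeff k (Suc s) = (-1) ^ m * of_int d * of_nat (binom (2 * m + s) (int s))"
    by (simp add: A3_coeff_def k d_def algebra_simps)
  have 4: "2 * k - Suc s = 2 * m + s + 1" by (simp add: k)
  show ?thesis
    unfolding 1 2 3 4 binom_rec by (simp add: algebra_simps)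
qed

definition A3_sum :: "nat \<Rightarrow> (complex \<Rightarrow> complex) \<Rightarrow> complex \<Rightarrow> complex" where
  "A3_sum k f z = (\<Sum>s=0..k. A3_coeff k s * (1 / z ^ (2 * k - s)) * (deriv ^^ s) f z)"

lemma A3_sum_has_field_derivative:
  assumes "f analytic_on {z}" "z \<noteq> 0" "k \<ge> 1"
  shows "(A3_sum k f has_field_derivative z * A3_sum (Suc k) f z) (at z)"
proof -
  \<comment> \<open>These are the monomials of the next sum. With \<open>n = 2k - s\<close>,
    \<open>z * X (Suc s)\<close> and \<open>z * X s\<close> carry the powers \<open>1 / z^n\<close>
    and \<open>1 / z^(n+1)\<close> that the product rule produces.\<close>
  define X where "X s = (1 / z ^ (2 * Suc k - s)) * (deriv ^^ s) f z" for s
  define c where "c = A3_coeff k"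
  have term_deriv: "((\<lambda>w. A3_coeff k s * (1 / w ^ (2 * k - s)) * (deriv ^^ s) f w) has_field_derivative
      z * (c s * X (Suc s) - of_nat (2 * k - s) * c s * X s)) (at z)" if "s \<le> k" for s
  proof -
    define n where "n = 2 * k - s"
    have n: "2 * Suc k - Suc s = Suc n" "2 * Suc k - s = Suc (Suc n)"
      using that by (auto simp: n_def)
    have "((\<lambda>w. w powi (- int n)) has_field_derivative - of_nat n * z powi (- int n - 1)) (at z)"
      using assms(2) by (auto intro!: derivative_eq_intros)
    moreover have "- int n - 1 = - int (Suc n)" by simp
    ultimately have "((\<lambda>w. 1 / w ^ n) has_field_derivative - of_nat n / z ^ Suc n) (at z)"
      by (simp only: power_int_minus power_int_of_nat divide_inverse mult_1_left)
    moreover have "(deriv ^^ s) f analytic_on {z}"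
      using assms(1) by (intro analytic_intros)
    then have "((deriv ^^ s) f has_field_derivative (deriv ^^ Suc s) f z) (at z)"
      by (simp add: analytic_derivI)
    ultimately have "((\<lambda>w. c s * (1 / w ^ n) * (deriv ^^ s) f w) has_field_derivative
        c s * (- of_nat n / z ^ Suc n) * (deriv ^^ s) f z
        + (deriv ^^ Suc s) f z * (c s * (1 / z ^ n))) (at z)"
      by (rule DERIV_mult[OF DERIV_cmult])
    then show ?thesis
      unfolding X_def n n_def[symmetric] c_def[symmetric]
      by (rule DERIV_cong) (use assms(2) in \<open>simp add: field_simps\<close>)
  qed
  \<comment> \<open>Both boundary coefficients vanish, so the index of the \<open>X s\<close> part
    can be shifted by one without leaving end terms.\<close>
  have "c 0 = 0" "c (Suc k) = 0"
    using assms(3) by (simp_all add: c_def A3_coeff_above_diag)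
  have "(\<Sum>s=0..k. of_nat (2 * k - Suc s) * c (Suc s) * X (Suc s)) =
      (\<Sum>s=0..Suc k. of_nat (2 * k - s) * c s * X s)"
    unfolding sum.atLeast0_atMost_Suc_shift using \<open>c 0 = 0\<close> by simp
  then have shift: "(\<Sum>s=0..k. of_nat (2 * k - Suc s) * c (Suc s) * X (Suc s)) =
      (\<Sum>s=0..k. of_nat (2 * k - s) * c s * X s)"
    using \<open>c (Suc k) = 0\<close> by simp
  have "A3_sum (Suc k) f z = (\<Sum>s=0..Suc k. A3_coeff (Suc k) s * X s)"
    unfolding A3_sum_def X_def by (simp only: mult.assoc)
  also have "\<dots> = (\<Sum>s=0..k. A3_coeff (Suc k) (Suc s) * X (Suc s))"
    unfolding sum.atLeast0_atMost_Suc_shift by simp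
  also have "\<dots> = (\<Sum>s=0..k. c s * X (Suc s) - of_nat (2 * k - Suc s) * c (Suc s) * X (Suc s))"
    using assms(3) by (intro sum.cong) (auto simp: A3_coeff_Suc c_def left_diff_distrib)
  also have "\<dots> = (\<Sum>s=0..k. c s * X (Suc s) - of_nat (2 * k - s) * c s * X s)"
    by (simp only: sum_subtractf shift)
  finally have "z * A3_sum (Suc k) f z =
      (\<Sum>s=0..k. z * (c s * X (Suc s) - of_nat (2 * k - s) * c s * X s))"
    by (simp only: sum_distrib_left)
  then show ?thesis
    unfolding A3_sum_def[of k, abs_def] by (simp only:) (intro DERIV_sum term_deriv, simp)
qed

lemma A3_sum_analytic:
  assumes "f analytic_on {z}" "z \<noteq> 0"
  shows "A3_sum k f analytic_on {z}"
  unfolding A3_sum_def[abs_def] using assms by (auto intro!: analytic_intros)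

lemma A3_remove_sings_A3_sum:
  assumes "f meromorphic_on UNIV" "k \<ge> 1"
  shows "A3 (remove_sings (A3_sum k f)) = remove_sings (A3_sum (Suc k) f)"
  unfolding A3_def
proof (rule ext, rule remove_sings_cong)
  fix z :: complex
  have "\<forall>\<^sub>F w in at z. f analytic_on {w}"
    using assms(1) isolated_singularity_at_altdef meromorphic_on_altdef by blast
  moreover have "\<forall>\<^sub>F w in at z. w \<noteq> 0"
    by (rule eventually_neq_at_within)
  ultimately show "\<forall>\<^sub>F w in at z. 1 / w * deriv (remove_sings (A3_sum k f)) w = A3_sum (Suc k) f w"
  proof eventually_elim
    case (elim w)
    \<comment> \<open>The sum is analytic at \<open>w\<close>, so the inner
      \<open>remove_sings\<close> does not affect the derivative there, and \<open>1 / w\<close>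
      cancels the factor \<open>w\<close> since \<open>w\<close> is nonzero.\<close>
    then show ?case
      using assms(2) DERIV_imp_deriv[OF A3_sum_has_field_derivative]
      by (simp add: A3_sum_analytic)
  qed
qed simp

theorem theorem5p2:
  fixes f :: "complex \<Rightarrow> complex" and k :: nat
  assumes "f meromorphic_on UNIV" and "k \<ge> 1"
  shows "(A3 ^^ k) f =
    remove_sings (\<lambda>z. \<Sum>s=0..k.
      (-1) ^ (k - s)
      * of_int (dfact (2 * int k - 2 * int s - 1))
      * of_nat (binom (2 * k - s - 1) (int s - 1))
      * (1 / z ^ (2 * k - s))
      * (deriv ^^ s) f z)"
proof -
  have "(A3 ^^ k) f = remove_sings (A3_sum k f)"
    using assms(2)
  \<comment> \<open>The induction must start at 1: \<open>A3_coeff 0 0 = 0\<close> makes the sum for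
    \<open>k = 0\<close> vanish, whereas the empty composition is the identity.\<close>
  proof (induction k rule: nat_induct_at_least)
    case base
    have "A3_sum 1 f = (\<lambda>z. 1 / z * deriv f z)"
      by (rule ext) (simp add: A3_sum_def A3_coeff_diag[of 0, simplified])
    then show ?case by (simp add: A3_def)
  next
    case (Suc k)
    then show ?case using A3_remove_sings_A3_sum[OF assms(1)] by simp
  qed
  then show ?thesis
    by (simp only: A3_sum_def[abs_def] A3_coeff_def)
qed

end
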